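(* Let $k\ge 2$ and $f\in P_k^n$ with $ess(f)\ge 2$. If $gap(f)\ge 2$, then every nonempty subset of $Ess(f)$ is separable in $f$.
   Context: $Z_k=\{0,1,\dots,k-1\}$; $P_k^n$ is the set of all maps $f:Z_k^n\to Z_k$ in the variables $x_1,\dots,x_n$. A variable $x_i$ is essential in $f$ if there are $a_1,\dots,a_n,b\in Z_k$ with $f(a_1,\dots,a_i,\dots,a_n)\ne f(a_1,\dots,a_{i-1},b,a_{i+1},\dots,a_n)$; $Ess(f)$ is the set of essential variables and $ess(f)=|Ess(f)|$. Subfunctions: for essential $x_i$ and $c\in Z_k$, $f(x_i=c)$ is obtained by assigning $c$ to $x_i$; $f\succ g$ means $g=f(x_i=c)$ for some such $x_i,c$; $\succeq$ is the reflexive-transitive closure of $\succ$. A nonempty $M\subseteq Ess(f)$ is separable in $f$ if $M=Ess(g)$ for some $g$ with $f\succeq g$. Minors: for distinct essential $x_i,x_j$, $f_{i\leftarrow j}(a_1,\dots,a_n)=f(a_1,\dots,a_{i-1},a_j,a_{i+1},\dots,a_n)$; $f\rhd h$ means $h=f_{i\leftarrow j}$ for some such $i,j$; $Mnr(f)$ is the set of all $h$ reachable from $f$ by one or more steps of $\rhd$. The (essential) arity gap is $gap(f)=ess(f)-\max_{h\in Mnr(f)}ess(h)$. *)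

theory Defs
  imports Main
begin

text \<open>Tuples in Z_k^n are modelled as functions nat => nat; the variable x_(i+1) is index i.
  Coordinates at positions >= n are fixed to 0.\<close>

definition tuples :: "nat \<Rightarrow> nat \<Rightarrow> (nat \<Rightarrow> nat) set" where
  "tuples k n = {a. (\<forall>i<n. a i < k) \<and> (\<forall>i\<ge>n. a i = 0)}"

text \<open>f is in P_k^n: maps Z_k^n into Z_k (values outside the domain are irrelevant).\<close>
definition in_Pkn :: "nat \<Rightarrow> nat \<Rightarrow> ((nat \<Rightarrow> nat) \<Rightarrow> nat) \<Rightarrow> bool" where
  "in_Pkn k n f \<longleftrightarrow> (\<forall>a\<in>tuples k n. f a < k)"

definition essential :: "nat \<Rightarrow> nat \<Rightarrow> ((nat \<Rightarrow> nat) \<Rightarrow> nat) \<Rightarrow> nat \<Rightarrow> bool" where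
  "essential k n f i \<longleftrightarrow> i < n \<and> (\<exists>a\<in>tuples k n. \<exists>b<k. f a \<noteq> f (a(i := b)))"

definition Ess :: "nat \<Rightarrow> nat \<Rightarrow> ((nat \<Rightarrow> nat) \<Rightarrow> nat) \<Rightarrow> nat set" where
  "Ess k n f = {i. essential k n f i}"

definition ess :: "nat \<Rightarrow> nat \<Rightarrow> ((nat \<Rightarrow> nat) \<Rightarrow> nat) \<Rightarrow> nat" where
  "ess k n f = card (Ess k n f)"

definition subf_step :: "nat \<Rightarrow> nat \<Rightarrow> ((nat \<Rightarrow> nat) \<Rightarrow> nat) \<Rightarrow> ((nat \<Rightarrow> nat) \<Rightarrow> nat) \<Rightarrow> bool" where
  "subf_step k n f g \<longleftrightarrow> (\<exists>i c. essential k n f i \<and> c < k \<and> g = (\<lambda>a. f (a(i := c))))"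

definition separable :: "nat \<Rightarrow> nat \<Rightarrow> ((nat \<Rightarrow> nat) \<Rightarrow> nat) \<Rightarrow> nat set \<Rightarrow> bool" where
  "separable k n f M \<longleftrightarrow> M \<noteq> {} \<and> M \<subseteq> Ess k n f \<and>
     (\<exists>g. (subf_step k n)\<^sup>*\<^sup>* f g \<and> M = Ess k n g)"

definition minor_step :: "nat \<Rightarrow> nat \<Rightarrow> ((nat \<Rightarrow> nat) \<Rightarrow> nat) \<Rightarrow> ((nat \<Rightarrow> nat) \<Rightarrow> nat) \<Rightarrow> bool" where
  "minor_step k n f h \<longleftrightarrow> (\<exists>i j. i \<noteq> j \<and> essential k n f i \<and> essential k n f j \<and>
      h = (\<lambda>a. f (a(i := a j))))"

definition Mnr :: "nat \<Rightarrow> nat \<Rightarrow> ((nat \<Rightarrow> nat) \<Rightarrow> nat) \<Rightarrow> ((nat \<Rightarrow> nat) \<Rightarrow> nat) set" where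
  "Mnr k n f = {h. (minor_step k n)\<^sup>+\<^sup>+ f h}"

definition gap :: "nat \<Rightarrow> nat \<Rightarrow> ((nat \<Rightarrow> nat) \<Rightarrow> nat) \<Rightarrow> int" where
  "gap k n f = int (ess k n f) - int (Max (ess k n ` Mnr k n f))"

end

theory Submission
  imports Defs
begin

text \<open>A set \<open>M\<close> of essential variables is separable as soon as the variables outside \<open>M\<close> can be fixed
  so that every variable in \<open>M\<close> stays essential. A gap of at least 2 means that every
  one-step minor \<open>f_(i <- j)\<close> loses some further essential variable. Let \<open>D\<close> be the set of tuples
  with a repeated entry among the essential variables.

  If no minor \<open>f_(i <- j)\<close> depends on the merged variable \<open>j\<close>, then a repeated pair may be changed
  to any other repeated pair, so \<open>f\<close> is symmetric on \<open>D\<close>, and a change of value along one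
  coordinate inside \<open>D\<close> can be moved to every coordinate of \<open>M\<close>.

  Otherwise take a minor depending on its merged variable whose number of other essential
  variables is maximal, and let \<open>l\<close> be inessential in it. Maximality forces all the minors
  \<open>f_(l <- p)\<close> to coincide (for at least four essential variables), and then \<open>f\<close> agrees on \<open>D\<close> with
  a function \<open>g\<close> not depending on two of the variables. As \<open>f\<close> depends on them, it differs from \<open>g\<close>
  at a tuple \<open>a\<close> outside \<open>D\<close>; fixing the variables outside \<open>M\<close> as in \<open>a\<close>, or as in \<open>a\<close> with a
  repetition introduced there, keeps all of \<open>M\<close> essential. With three essential variables four
  patterns remain, among them the majority and minority patterns.\<close>

section \<open>Dependence on variables and identification of two variables\<close>

definition depends :: "(('v \<Rightarrow> 'a) \<Rightarrow> 'b) \<Rightarrow> 'v \<Rightarrow> bool" where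
  "depends F i \<longleftrightarrow> (\<exists>x b. F (x(i := b)) \<noteq> F x)"

definition minor :: "(('v \<Rightarrow> 'a) \<Rightarrow> 'b) \<Rightarrow> 'v \<Rightarrow> 'v \<Rightarrow> ('v \<Rightarrow> 'a) \<Rightarrow> 'b" where
  "minor F i j = (\<lambda>x. F (x(i := x j)))"

definition repeats :: "'v set \<Rightarrow> ('v \<Rightarrow> 'a) \<Rightarrow> bool" where
  "repeats E x \<longleftrightarrow> (\<exists>r\<in>E. \<exists>s\<in>E. r \<noteq> s \<and> x r = x s)"

text \<open>One assignment \<open>c\<close> outside \<open>M\<close> must serve all \<open>i\<close>
  in \<open>M\<close>, while \<open>x\<close> may vary with \<open>i\<close> inside
  \<open>M\<close>. This is separability without chains of subfunctions.\<close>

definition keeps_essential :: "(('v \<Rightarrow> 'a) \<Rightarrow> 'b) \<Rightarrow> 'v set \<Rightarrow> bool" where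
  "keeps_essential F M \<longleftrightarrow> (\<exists>c. \<forall>i\<in>M. \<exists>x b. (\<forall>j. j \<notin> M \<longrightarrow> x j = c j) \<and> F (x(i := b)) \<noteq> F x)"

lemma not_dependsD: "\<not> depends F i \<Longrightarrow> F (x(i := b)) = F x"
  by (auto simp: depends_def)

lemma repeatsI: "r \<in> E \<Longrightarrow> s \<in> E \<Longrightarrow> r \<noteq> s \<Longrightarrow> x r = x s \<Longrightarrow> repeats E x"
  by (auto simp: repeats_def)

lemma minor_eq_if: "x i = x j \<Longrightarrow> minor F i j x = F x"
  by (metis minor_def fun_upd_triv)

lemma not_depends_minor: "i \<noteq> j \<Longrightarrow> \<not> depends (minor F i j) i"
  by (simp add: depends_def minor_def)

lemma depends_minor_other:
  assumes "depends (minor F i j) r" "r \<noteq> i" "r \<noteq> j"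
  shows "depends F r"
proof -
  obtain x b where "F (x(r := b, i := x j)) \<noteq> F (x(i := x j))"
    using assms by (auto simp: depends_def minor_def)
  then show ?thesis
    using assms(2) not_dependsD[of F r "x(i := x j)" b] by (auto simp: fun_upd_twist)
qed

lemma depends_minor_block:
  assumes "depends (minor F i j) j" "i \<noteq> j"
  shows "depends F i \<or> depends F j"
proof (rule ccontr)
  assume "\<not> ?thesis"
  then have "minor F i j (x(j := b)) = minor F i j x" for x b
    by (simp add: minor_def not_dependsD)
  then show False using assms by (auto simp: depends_def)
qed

text \<open>\<open>minor F i j x\<close> equals \<open>minor F j i (x(i := x j))\<close>. Without
  dependence on \<open>i\<close> the two minors would be equal, yet \<open>minor F j i\<close> never
  depends on \<open>j\<close>.\<close>

lemma depends_minor_commute: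
  assumes "i \<noteq> j"
  shows "depends (minor F i j) j \<longleftrightarrow> depends (minor F j i) i"
proof -
  have "depends (minor F j i) i" if "depends (minor F i j) j" "i \<noteq> j" for i j
  proof (rule ccontr)
    assume a: "\<not> depends (minor F j i) i"
    have "minor F i j x = minor F j i (x(i := x j))" for x
      by (simp add: minor_def fun_upd_idem)
    then have "minor F i j x = minor F j i x" for x using a by (simp add: not_dependsD)
    then have "minor F i j = minor F j i" by auto
    then show False using that not_depends_minor[of j i F] by simp
  qed
  then show ?thesis using assms by blast
qed

lemma depends_minor_commute_other:
  assumes "i \<noteq> j" "r \<noteq> i" "r \<noteq> j"
  shows "depends (minor F i j) r \<longleftrightarrow> depends (minor F j i) r"
proof -
  have "depends (minor F j i) r" if "depends (minor F i j) r" "i \<noteq> j" "r \<noteq> i" "r \<noteq> j" for i j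
  proof (rule ccontr)
    assume a: "\<not> depends (minor F j i) r"
    have e: "minor F i j x = minor F j i (x(i := x j))" for x
      by (simp add: minor_def fun_upd_idem)
    have "minor F i j (x(r := b)) = minor F i j x" for x b
      using a that not_dependsD[OF a, of "x(i := x j)" b] unfolding e
      by (simp add: fun_upd_twist)
    then show False using that by (auto simp: depends_def)
  qed
  then show ?thesis using assms by blast
qed

lemma keeps_essential_singleton: "depends F i \<Longrightarrow> keeps_essential F {i}"
  unfolding keeps_essential_def depends_def by blast

section \<open>Criteria for keeping all of \<open>M\<close> essential\<close>

text \<open>Two ways to fix the outer variables are tried: a tuple \<open>a\<close> with
  \<open>F a \<noteq> g a\<close>, then \<open>a\<close> with a repetition at \<open>l\<close> and
  \<open>q\<close>, a change invisible to \<open>g\<close>. If both fail, \<open>g a\<close> equals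
  \<open>g (a(i := a j))\<close>, which is \<open>F a\<close>.\<close>

lemma keeps_essential_if_diagonal_eq:
  assumes j: "j \<in> E" "j \<notin> M" and ME: "M \<subseteq> E"
    and lq: "l \<in> E" "q \<in> E" "l \<noteq> q" "\<not> depends g l" "\<not> depends g q"
    and eq: "\<And>x. repeats E x \<Longrightarrow> F x = g x"
    and l: "depends F l"
  shows "keeps_essential F M"
proof -
  obtain a where a: "F a \<noteq> g a"
  proof -
    obtain x b where "F (x(l := b)) \<noteq> F x" using l by (auto simp: depends_def)
    moreover have "g (x(l := b)) = g x" using lq by (simp add: not_dependsD)
    ultimately show ?thesis using that by metis
  qed
  show ?thesis
  proof (rule ccontr)
    assume ns: "\<not> keeps_essential F M"
    then obtain i where i: "i \<in> M"
      and ind: "\<And>x b. (\<forall>j. j \<notin> M \<longrightarrow> x j = a j) \<Longrightarrow> F (x(i := b)) = F x"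
      unfolding keeps_essential_def by metis
    have ij: "i \<noteq> j" "i \<in> E" using i j ME by auto
    have gi: "F a = g (a(i := a j))"
    proof -
      have "F a = F (a(i := a j))" using ind[of a] by simp
      also have "\<dots> = g (a(i := a j))"
        by (rule eq, rule repeatsI[of i _ j]) (use ij j in auto)
      finally show ?thesis .
    qed
    have o1: "g (a(y := a j)) = g (a(y := a j, i := a j))" if y: "y \<in> M" "y \<noteq> i" for y
    proof -
      have r: "g (a(y := a j)) = F (a(y := a j))"
        by (rule eq[symmetric], rule repeatsI[of y _ j]) (use y ME j in auto)
      have r': "g (a(y := a j, i := a j)) = F (a(y := a j, i := a j))"
        by (rule eq[symmetric], rule repeatsI[of i _ j]) (use y ij ME j in auto)
      show ?thesis unfolding r r' by (rule ind[symmetric]) (use y in auto)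
    qed
    \<comment> \<open>Otherwise \<open>y\<close> could be moved to \<open>a j\<close> and back under
      \<open>g\<close>, giving \<open>g a = F a\<close>. Hence \<open>l\<close> and \<open>q\<close>
      lie outside \<open>M\<close>.\<close>
    have dg: "depends g y" if y: "y \<in> M" for y
    proof (rule ccontr)
      assume n: "\<not> depends g y"
      then have yi: "y \<noteq> i" using gi a by (auto simp: not_dependsD)
      have "g a = g (a(y := a j, i := a j))" using n o1[OF y yi] by (simp add: not_dependsD)
      also have "\<dots> = g (a(i := a j))" using n yi by (simp add: fun_upd_twist[of y i] not_dependsD)
      finally show False using gi a by simp
    qed
    then have lqM: "l \<notin> M" "q \<notin> M" using lq by auto
    \<comment> \<open>Every tuple agreeing with \<open>c\<close> outside \<open>M\<close> has equal
      entries at \<open>l\<close> and \<open>q\<close>, so \<open>F\<close> and \<open>g\<close>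
      coincide on it.\<close>
    define c where "c = a(l := a q)"
    have gc: "g (c(y := b)) = g (a(y := b))" "g c = g a" "g (c(y := b, z := d)) = g (a(y := b, z := d))"
      if "y \<in> M" "z \<in> M" for y z b d
    proof -
      have "y \<noteq> l" "z \<noteq> l" using that lqM by auto
      then show "g (c(y := b)) = g (a(y := b))" "g c = g a" "g (c(y := b, z := d)) = g (a(y := b, z := d))"
        unfolding c_def
        using not_dependsD[OF lq(4), of "a(y := b)" "a q"] not_dependsD[OF lq(4), of "a" "a q"]
         not_dependsD[OF lq(4), of "a(y := b, z := d)" "a q"]
        by (simp_all add: fun_upd_twist)
    qed
    from ns obtain y where y: "y \<in> M"
      and indy: "\<And>x b. (\<forall>j. j \<notin> M \<longrightarrow> x j = c j) \<Longrightarrow> F (x(y := b)) = F x"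
      unfolding keeps_essential_def by metis
    have Fg: "F x = g x" if "\<forall>j. j \<notin> M \<longrightarrow> x j = c j" for x
      by (rule eq, rule repeatsI[of l _ q]) (use that lq lqM in \<open>auto simp: c_def\<close>)
    have indy': "g (x(y := b)) = g x" if "\<forall>j. j \<notin> M \<longrightarrow> x j = c j" for x b
      using indy[of x b] Fg[of x] Fg[of "x(y := b)"] that y by auto
    have "g a = g (a(y := a j))" using indy'[of c "a j"] gc y by simp
    also have "\<dots> = g (a(i := a j))"
    proof (cases "y = i")
      case False
      have "g (a(y := a j)) = g (a(i := a j, y := a j))"
        using o1[OF y False] False by (simp add: fun_upd_twist)
      also have "\<dots> = g (c(i := a j, y := a j))" using gc y i by simp
      also have "\<dots> = g (c(i := a j))" by (rule indy') (use i in auto)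
      finally show ?thesis using gc y i by simp
    qed simp
    finally show False using gi a by simp
  qed
qed

text \<open>If no change along one coordinate inside the diagonal alters \<open>F\<close>, a minor serves as \<open>g\<close> in
  the previous lemma.\<close>
lemma keeps_essential_if_diagonal_symmetric:
  assumes ME: "M \<subseteq> E" "M \<noteq> {}" "j \<in> E" "j \<notin> M"
    and dep: "\<And>i. i \<in> E \<Longrightarrow> depends F i"
    and lpr: "l \<in> E" "p \<in> E" "r \<in> E" "l \<noteq> p" "l \<noteq> r" "p \<noteq> r"
    and swap: "\<And>x i y. repeats E x \<Longrightarrow> i \<in> E \<Longrightarrow> y \<in> E \<Longrightarrow> F (x(i := x y, y := x i)) = F x"
  shows "keeps_essential F M"
proof (cases "\<exists>x i b. i \<in> E \<and> repeats E x \<and> repeats E (x(i := b)) \<and> F (x(i := b)) \<noteq> F x")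
  case False
  then have st: "F (x(i := b)) = F x" if "i \<in> E" "repeats E x" "repeats E (x(i := b))" for x i b
    using that by blast
  \<comment> \<open>\<open>l\<close> is parked at the value of \<open>r\<close> while
    \<open>p\<close> changes, and then follows \<open>p\<close>; each of the three moves stays on
    the diagonal.\<close>
  have np: "minor F l p (x(p := b)) = minor F l p x" for x b
  proof -
    have "F (x(l := x p)) = F (x(l := x p, l := x r))"
      by (rule st[symmetric])
        (use lpr in \<open>auto intro: repeatsI[of l _ p] repeatsI[of l _ r]\<close>)
    also have "\<dots> = F (x(l := x p, l := x r, p := b))"
      by (rule st[symmetric])
        (use lpr in \<open>auto intro: repeatsI[of l _ p] repeatsI[of l _ r]\<close>)
    also have "\<dots> = F (x(l := x p, l := x r, p := b, l := b))"
      by (rule st[symmetric])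
        (use lpr in \<open>auto intro: repeatsI[of l _ p] repeatsI[of l _ r]\<close>)
    finally show ?thesis using lpr by (simp add: minor_def fun_upd_twist)
  qed
  show ?thesis
  proof (rule keeps_essential_if_diagonal_eq[where l = l and q = p and g = "minor F l p"])
    show "\<not> depends (minor F l p) p" using np by (simp add: depends_def)
    show "\<not> depends (minor F l p) l" using lpr by (simp add: not_depends_minor)
    show "F x = minor F l p x" if "repeats E x" for x unfolding minor_def
      by (rule st[symmetric]) (use lpr that in \<open>auto intro: repeatsI[of l _ p]\<close>)
  qed (use assms in auto)
next
  case True
  have repswap: "repeats E (x(i := x y, y := x i))"
    if x: "repeats E x" and i: "i \<in> E" and y: "y \<in> E" for x :: "'a \<Rightarrow> 'b" and i y
  proof -
    let ?t = "\<lambda>z. if z = i then y else if z = y then i else z"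
    obtain r s where rs: "r \<in> E" "s \<in> E" "r \<noteq> s" "x r = x s" using x by (auto simp: repeats_def)
    show ?thesis by (rule repeatsI[of "?t r" _ "?t s"]) (use rs i y in auto)
  qed
  have main: "F (x(i := x y, y := b)) \<noteq> F (x(i := x y, y := x i))"
    if "i \<in> E" "y \<in> E" "repeats E x" "repeats E (x(i := b))" "F (x(i := b)) \<noteq> F x" for x i y b
    using swap[OF that(3,1,2)] swap[OF that(4,1,2)] that(5) by (cases "y = i") auto
  \<comment> \<open>The change is first moved to a coordinate of \<open>M\<close>; exchanges within
    \<open>M\<close> then leave the outer assignment fixed.\<close>
  obtain x i b where x: "i \<in> M" "repeats E x" "repeats E (x(i := b))" "F (x(i := b)) \<noteq> F x"
  proof -
    obtain x i b where x: "i \<in> E" "repeats E x" "repeats E (x(i := b))" "F (x(i := b)) \<noteq> F x"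
      using True by blast
    obtain y where y: "y \<in> M" using ME by auto
    let ?x = "x(i := x y, y := x i)"
    have "repeats E ?x" using repswap x y ME by blast
    moreover have "repeats E (?x(y := b))"
      using repswap[OF x(3), of i y] x y ME by (cases "y = i") auto
    ultimately show ?thesis using that[of y ?x b] main[of i y x b] x y ME by auto
  qed
  show ?thesis unfolding keeps_essential_def
  proof (rule exI[of _ x], rule ballI)
    fix y assume y: "y \<in> M"
    show "\<exists>z d. (\<forall>j. j \<notin> M \<longrightarrow> z j = x j) \<and> F (z(y := d)) \<noteq> F z"
      using main[of i y x b] x y ME
      by (intro exI[of _ "x(i := x y, y := x i)"] exI[of _ b]) auto
  qed
qed

section \<open>Functions whose one-step minors all lose a further variable\<close>

locale nontrivial_gap =
  fixes F :: "('v \<Rightarrow> 'a) \<Rightarrow> 'b" and E :: "'v set"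
  assumes finite_E: "finite E"
    and F_cong: "(\<And>i. i \<in> E \<Longrightarrow> x i = y i) \<Longrightarrow> F x = F y"
    and dep: "i \<in> E \<Longrightarrow> depends F i"
    and loss: "i \<in> E \<Longrightarrow> j \<in> E \<Longrightarrow> i \<noteq> j \<Longrightarrow> \<exists>l\<in>E - {i}. \<not> depends (minor F i j) l"
begin

text \<open>By \<open>cancel\<close>, two equal entries may move together to any common value
  without changing \<open>F\<close>; an exchange is composed of such moves.\<close>

lemma swap_if_cancel:
  assumes cancel: "\<And>i j. i \<in> E \<Longrightarrow> j \<in> E \<Longrightarrow> i \<noteq> j \<Longrightarrow> \<not> depends (minor F i j) j"
    and x: "repeats E x" and i: "i \<in> E" and l: "l \<in> E"
  shows "F (x(i := x l, l := x i)) = F x"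
proof (cases "i = l \<or> x i = x l")
  case True then show ?thesis by (metis fun_upd_triv)
next
  case False
  have c: "F (x(i := b, j := b)) = F x" if "i \<in> E" "j \<in> E" "i \<noteq> j" "x i = x j" for i j x b
  proof -
    have "minor F i j (x(j := b)) = minor F i j x" using cancel that by (simp add: not_dependsD)
    then show ?thesis using that by (simp add: minor_def fun_upd_twist fun_upd_idem)
  qed
  have two: "F (x(i := x l, l := x i)) = F x"
    if "i \<in> E" "j \<in> E" "l \<in> E" "x i = x j" "i \<noteq> j" "i \<noteq> l" "j \<noteq> l" for x i j l
  proof -
    have "F x = F (x(i := x l, j := x l))" using that by (simp add: c)
    also have "\<dots> = F (x(i := x l, j := x l, j := x i, l := x i))"
      by (rule c[symmetric]) (use that in auto)
    also have "\<dots> = F (x(i := x l, l := x i))"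
      using that by (intro arg_cong[of _ _ F]) auto
    finally show ?thesis by simp
  qed
  obtain p q where pq: "p \<in> E" "q \<in> E" "p \<noteq> q" "x p = x q" using x by (auto simp: repeats_def)
  consider j where "j \<in> E" "x i = x j" "i \<noteq> j" "j \<noteq> l"
    | j where "j \<in> E" "x l = x j" "l \<noteq> j" "j \<noteq> i"
    | "p \<notin> {i, l}" "q \<notin> {i, l}"
    using pq False by (metis insertE singletonD)
  then show ?thesis
  proof cases
    case (1 j)
    then show ?thesis using two[of i j l x] i l False by auto
  next
    case (2 j)
    then show ?thesis using two[of l j i x] i l False by (metis fun_upd_twist)
  next
    case 3
    have ne: "p \<noteq> i" "p \<noteq> l" "q \<noteq> i" "q \<noteq> l" "i \<noteq> l" using 3 False by auto
    \<comment> \<open>The pair \<open>p\<close>, \<open>q\<close> is scratch space: it takes the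
      value of \<open>i\<close>, then \<open>q\<close> moves together with \<open>i\<close> and next
      with \<open>l\<close>, and finally the pair is restored.\<close>
    let ?x1 = "x(p := x i, q := x i)"
    let ?x2 = "?x1(q := x l, i := x l)"
    let ?x3 = "?x2(q := x i, l := x i)"
    have "F x = F ?x1" using pq by (simp add: c)
    also have "\<dots> = F ?x2" by (rule c[symmetric]) (use pq i ne in auto)
    also have "\<dots> = F ?x3" by (rule c[symmetric]) (use pq l ne in auto)
    also have "\<dots> = F (?x3(p := x p, q := x p))" by (rule c[symmetric]) (use pq ne in auto)
    also have "\<dots> = F (x(i := x l, l := x i))"
      using pq ne by (intro arg_cong[of _ _ F]) auto
    finally show ?thesis by simp
  qed
qed

section \<open>Maximal pairs and the minors they force to coincide\<close>

text \<open>Leaving out the merged variable makes this set symmetric in \<open>i\<close> and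
  \<open>j\<close>.\<close>

definition R :: "'v \<Rightarrow> 'v \<Rightarrow> 'v set" where
  "R i j = {r \<in> E - {i, j}. depends (minor F i j) r}"

lemma finite_R [simp]: "finite (R i j)"
  using finite_E by (simp add: R_def)

lemma R_commute: "i \<noteq> j \<Longrightarrow> R i j = R j i"
  by (auto simp: R_def depends_minor_commute_other)

definition maximal_pair :: "'v \<Rightarrow> 'v \<Rightarrow> bool" where
  "maximal_pair i j \<longleftrightarrow> i \<in> E \<and> j \<in> E \<and> i \<noteq> j \<and> depends (minor F i j) j \<and>
    (\<forall>p\<in>E. \<forall>q\<in>E. p \<noteq> q \<longrightarrow> depends (minor F p q) q \<longrightarrow> card (R p q) \<le> card (R i j))"

lemma maximal_pair_commute: "maximal_pair i j \<Longrightarrow> maximal_pair j i"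
  using R_commute depends_minor_commute unfolding maximal_pair_def by metis

lemma ex_maximal_pair:
  assumes "i \<in> E" "j \<in> E" "i \<noteq> j" "depends (minor F i j) j"
  shows "\<exists>i j. maximal_pair i j"
proof -
  let ?S = "{(p, q). p \<in> E \<and> q \<in> E \<and> p \<noteq> q \<and> depends (minor F p q) q}"
  have "finite ?S" by (rule finite_subset[of _ "E \<times> E"]) (use finite_E in auto)
  moreover have "?S \<noteq> {}" using assms by auto
  ultimately have "\<exists>s\<in>?S. \<forall>t\<in>?S. card (case t of (p, q) \<Rightarrow> R p q) \<le> card (case s of (p, q) \<Rightarrow> R p q)"
    using finite_imageI[of ?S "\<lambda>t. card (case t of (p, q) \<Rightarrow> R p q)"]
      Max_in[of "(\<lambda>t. card (case t of (p, q) \<Rightarrow> R p q)) ` ?S"]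
      Max_ge[of "(\<lambda>t. card (case t of (p, q) \<Rightarrow> R p q)) ` ?S"]
    by (smt (verit, ccfv_threshold) image_iff image_is_empty)
  then show ?thesis unfolding maximal_pair_def by fastforce
qed

text \<open>Once \<open>i\<close> and \<open>j\<close> are identified the value of \<open>l\<close>
  is irrelevant, so replacing \<open>l\<close> by \<open>s\<close> beforehand has no effect.\<close>

lemma collapse:
  assumes mp: "maximal_pair i j" and l: "l \<in> E - {i, j}" "\<not> depends (minor F i j) l" and s: "s \<noteq> l"
  shows "minor (minor F l s) j i = minor F j i"
proof
  fix x
  have ij: "i \<noteq> j" using mp by (simp add: maximal_pair_def)
  have nl: "\<not> depends (minor F j i) l" using l ij depends_minor_commute_other[of i j l F] by simp
  have "minor (minor F l s) j i x = minor F j i (x(l := (x(j := x i)) s))"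
    using l by (auto simp: minor_def fun_upd_twist[of j l])
  also have "\<dots> = minor F j i x" using nl by (rule not_dependsD)
  finally show "minor (minor F l s) j i x = minor F j i x" .
qed

text \<open>By \<open>collapse\<close>, dependence of the known minor pulls back to
  \<open>minor F l s\<close>. If the latter ignores one of \<open>i\<close>, \<open>j\<close>,
  identifying them leaves it unchanged, so it is itself a known minor.\<close>

lemma collapse_cases:
  assumes mp: "maximal_pair i j" and l: "l \<in> E - {i, j}" "\<not> depends (minor F i j) l" and s: "s \<noteq> l"
  shows "R i j \<subseteq> {r. depends (minor F l s) r}"
    and "depends (minor F l s) i \<or> depends (minor F l s) j"
    and "minor F l s = minor F j i \<or> depends (minor F l s) j"
    and "minor F l s = minor F i j \<or> depends (minor F l s) i"
proof -
  have ij: "i \<noteq> j" and d: "depends (minor F j i) i"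
    using mp maximal_pair_commute[OF mp] by (simp_all add: maximal_pair_def)
  note c = collapse[OF assms]
  show "R i j \<subseteq> {r. depends (minor F l s) r}"
    using depends_minor_other[of "minor F l s" j i] R_commute[OF ij] by (auto simp: R_def c)
  show "depends (minor F l s) i \<or> depends (minor F l s) j"
    using depends_minor_block[of "minor F l s" j i] d ij by (auto simp: c)
  have eq: "minor K a b = K" if "\<not> depends K a" for K :: "('v \<Rightarrow> 'a) \<Rightarrow> 'b" and a b
    using that by (auto simp: minor_def not_dependsD)
  show "minor F l s = minor F j i \<or> depends (minor F l s) j" using eq[of "minor F l s" j i] c by auto
  have "minor (minor F l s) i j = minor F i j"
    using collapse[OF maximal_pair_commute[OF mp], of l s] l s ij depends_minor_commute_other[of i j l F]
    by auto
  then show "minor F l s = minor F i j \<or> depends (minor F l s) i" using eq[of "minor F l s" i j] by auto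
qed

lemma minor_at_pair:
  assumes mp: "maximal_pair i j" and l: "l \<in> E - {i, j}" "\<not> depends (minor F i j) l"
  shows "minor F l i = minor F j i \<or> minor F l i = minor F i j"
proof (rule ccontr)
  assume n: "\<not> ?thesis"
  have il: "i \<noteq> l" "i \<in> E" "j \<in> E" "i \<noteq> j" using l mp by (auto simp: maximal_pair_def)
  note c = collapse_cases[OF assms il(1)]
  have "l \<notin> R i j" using l by (auto simp: R_def)
  \<comment> \<open>The pair \<open>(l, i)\<close> would then beat the maximal one.\<close>
  then have "insert j (R i j) \<subseteq> R l i" using c n l il by (auto simp: R_def)
  then have "card (insert j (R i j)) \<le> card (R l i)" by (simp add: card_mono)
  moreover have "j \<notin> R i j" by (simp add: R_def)
  moreover have "card (R l i) \<le> card (R i j)" using mp c n il l by (auto simp: maximal_pair_def)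
  ultimately show False by simp
qed

text \<open>This separates the two candidates of \<open>minor_at_pair\<close> on tuples where
  \<open>minor F l i\<close> and \<open>minor F l s\<close> agree. Equality there would express
  \<open>minor F i j\<close> through a function that ignores \<open>j\<close>.\<close>

lemma minors_differ_on_diagonal:
  assumes mp: "maximal_pair i j" and s: "s \<notin> {i, j}"
  shows "\<exists>x. x i = x s \<and> minor F i j x \<noteq> minor F j i x"
proof (rule ccontr)
  assume n: "\<not> ?thesis"
  have ij: "i \<noteq> j" and d: "depends (minor F i j) j" using mp by (simp_all add: maximal_pair_def)
  have e: "minor F i j x = minor F j i (x(i := x s))" for x
    using n s not_dependsD[OF not_depends_minor[OF ij], of F x "x s"]
    by (metis fun_upd_same fun_upd_other insertCI)
  have "minor F i j (x(j := b)) = minor F i j x" for x b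
    using not_dependsD[OF not_depends_minor[of j i F], of "x(i := x s)" b] ij s
    unfolding e by (simp add: fun_upd_twist)
  then show False using d by (simp add: depends_def)
qed

lemma minor_off_pair:
  assumes mp: "maximal_pair i j" and l: "l \<in> E - {i, j}" "\<not> depends (minor F i j) l"
    and s: "s \<in> E - {i, j, l}"
  shows "minor F l s = minor F l i"
proof (cases "s \<in> R i j")
  case True
  have ij: "i \<noteq> j" "i \<in> E" "j \<in> E" using mp by (simp_all add: maximal_pair_def)
  have sl: "s \<noteq> l" using s by auto
  note c = collapse_cases[OF mp l sl]
  \<comment> \<open>Otherwise \<open>R l s\<close> contains \<open>i\<close> and \<open>j\<close> in
    exchange for \<open>s\<close>, one element more than maximality allows.\<close>
  have "minor F l s = minor F j i \<or> minor F l s = minor F i j"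
  proof (rule ccontr)
    assume n: "\<not> ?thesis"
    then have d: "depends (minor F l s) i" "depends (minor F l s) j" using c by auto
    have "l \<notin> R i j" using l by (auto simp: R_def)
    then have "insert i (insert j (R i j - {s})) \<subseteq> R l s" using c d l s ij by (auto simp: R_def)
    then have "card (insert i (insert j (R i j - {s}))) \<le> card (R l s)" by (simp add: card_mono)
    moreover have "card (insert i (insert j (R i j - {s}))) = Suc (card (R i j))"
    proof -
      have "i \<notin> R i j" "j \<notin> R i j" by (auto simp: R_def)
      then show ?thesis using ij True card_Suc_Diff1[of "R i j" s] by simp
    qed
    moreover have "card (R l s) \<le> card (R i j)"
      using mp c True s l by (auto simp: maximal_pair_def)
    ultimately show False by simp
  qed
  moreover have "minor F l s x = minor F l i x" if "x i = x s" for x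
    using that by (simp add: minor_def)
  ultimately show ?thesis
    using minors_differ_on_diagonal[OF mp, of s] minor_at_pair[OF mp l] s by (metis DiffD2 insertCI insertE empty_iff)
next
  case False
  have ij: "i \<noteq> j" "i \<in> E" "j \<in> E" using mp by (simp_all add: maximal_pair_def)
  have sl: "s \<noteq> l" using s by auto
  note c = collapse_cases[OF mp l sl]
  have ns: "\<not> depends (minor F i j) s" using False s by (auto simp: R_def)
  then have ns': "\<not> depends (minor F l i) s"
    using minor_at_pair[OF mp l] s ij depends_minor_commute_other[of i j s F] by auto
  \<comment> \<open>Dependence on \<open>s\<close> would make \<open>(l, s)\<close> compete with the
    maximal pair, and \<open>R l s\<close> would contain \<open>R i j\<close> together with
    \<open>i\<close> or \<open>j\<close>.\<close>
  have nK: "\<not> depends (minor F l s) s"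
  proof
    assume d: "depends (minor F l s) s"
    have le: "card (R l s) \<le> card (R i j)" using mp d s l by (auto simp: maximal_pair_def)
    obtain z where z: "z \<in> {i, j}" "depends (minor F l s) z" using c by auto
    have "l \<notin> R i j" using l by (auto simp: R_def)
    then have "insert z (R i j) \<subseteq> R l s" using c z s l ij False by (auto simp: R_def)
    then have "card (insert z (R i j)) \<le> card (R l s)" by (simp add: card_mono)
    moreover have "z \<notin> R i j" using z by (auto simp: R_def)
    ultimately show False using le by simp
  qed
  show ?thesis
  proof
    fix x
    have "minor F l s x = minor F l s (x(s := x i))" using nK by (simp add: not_dependsD)
    also have "\<dots> = minor F l i (x(s := x i))" using s by (simp add: minor_def)
    also have "\<dots> = minor F l i x" using ns' by (simp add: not_dependsD)
    finally show "minor F l s x = minor F l i x" .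
  qed
qed

section \<open>Values on the diagonal from equal minors\<close>

text \<open>The claim is immediate when \<open>l\<close> shares its value with another variable. A
  repetition at \<open>r\<close>, \<open>s\<close> away from \<open>l\<close> is brought to that
  case by moving the variable \<open>t\<close> that \<open>minor F r s\<close> loses.\<close>

lemma diagonal_from_equal_minors:
  assumes card: "card E \<ge> 4" and l: "l \<in> E"
    and eq: "\<And>p. p \<in> E - {l} \<Longrightarrow> minor F l p = h"
    and x: "repeats E x"
  shows "F x = h x"
proof -
  obtain r s where rs: "r \<in> E" "s \<in> E" "r \<noteq> s" "x r = x s" using x by (auto simp: repeats_def)
  show ?thesis
  proof (cases "r = l \<or> s = l")
    case True
    then show ?thesis using eq[of r] eq[of s] minor_eq_if[of x l s F] minor_eq_if[of x l r F] rs by auto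
  next
    case False
    obtain t where t: "t \<in> E - {r}" "\<not> depends (minor F r s) t" using loss rs by blast
    have m: "minor F r s y = F y" if "y r = y s" for y using minor_eq_if that by metis
    have single: "F (y(t := b)) = F y" if "t \<noteq> s" "y r = y s" for y b
      using m[of y] m[of "y(t := b)"] not_dependsD[OF t(2), of y b] t that by auto
    have block: "F (y(r := b, s := b)) = F y" if "t = s" "y r = y s" for y b
      using m[of y] not_dependsD[OF t(2), of y b] rs that by (auto simp: minor_def fun_upd_twist)
    have lup: "h y = F (y(l := y p))" if "p \<in> E - {l}" for y p
      using eq[OF that] by (auto simp: minor_def)
    have at: "F y = h y" if "y l = y p" "p \<in> E - {l}" for y p
      using eq[OF that(2)] minor_eq_if[of y l p F] that(1) by simp
    consider "t = l" | "t = s" | "t \<notin> {l, r, s}" using t by auto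
    then show ?thesis
    proof cases
      case 1
      then show ?thesis using single[of x "x r"] lup[of r x] False rs by auto
    next
      case 2
      \<comment> \<open>A fourth variable is needed: \<open>l\<close> must take a value that does
        not move along with the block \<open>r\<close>, \<open>s\<close>.\<close>
      have "\<exists>p. p \<in> E - {l, r, s}"
      proof (rule ccontr)
        assume "\<not> ?thesis"
        then have "card E \<le> card {l, r, s}" by (intro card_mono) auto
        also have "\<dots> \<le> 3" by (simp add: card_insert_if)
        finally show False using card by simp
      qed
      then obtain p where p: "p \<in> E - {l, r, s}" by blast
      have "F x = F (x(r := x l, s := x l))" using block 2 rs by simp
      also have "\<dots> = h (x(r := x l, s := x l))" by (rule at[of _ r]) (use rs False in auto)
      also have "\<dots> = F (x(l := x p, r := x l, s := x l))"
        using lup[of p "x(r := x l, s := x l)"] p rs False by (simp add: fun_upd_twist)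
      also have "\<dots> = F (x(l := x p))" by (rule block) (use 2 rs False in auto)
      also have "\<dots> = h x" using lup[of p x] p by auto
      finally show ?thesis .
    next
      case 3
      have "F x = F (x(t := x l))" using single 3 rs by simp
      also have "\<dots> = h (x(t := x l))" by (rule at[of _ t]) (use t 3 in auto)
      also have "\<dots> = F (x(l := x r, t := x l))"
        using lup[of r "x(t := x l)"] 3 rs False by (auto simp: fun_upd_twist)
      also have "\<dots> = F (x(l := x r))" by (rule single) (use 3 rs False in auto)
      also have "\<dots> = h x" using lup[of r x] rs False by auto
      finally show ?thesis .
    qed
  qed
qed

section \<open>Exactly three essential variables\<close>

lemma keeps_essential_ternary:
  assumes mp: "maximal_pair i j" and l: "l \<in> E - {i, j}" "\<not> depends (minor F i j) l"
    and E: "E = {i, j, l}" and M: "M \<subseteq> E" "M \<noteq> {}" "c \<in> E" "c \<notin> M"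
  shows "keeps_essential F M"
proof -
  have ij: "i \<noteq> j" "i \<in> E" "j \<in> E" and d: "depends (minor F i j) j" using mp by (simp_all add: maximal_pair_def)
  have l': "\<not> depends (minor F j i) l" using l ij depends_minor_commute_other[of i j l F] by auto
  have ne: "l \<noteq> i" "l \<noteq> j" "i \<noteq> l" "j \<noteq> l" using l by auto
  \<comment> \<open>Since \<open>l\<close> is lost, both minors of the pair read a single
    coordinate, through the values of \<open>F\<close> on constant tuples.\<close>
  define h where "h = (\<lambda>u. F (\<lambda>_. u))"
  have G1: "minor F j i x = h (x i)" for x
  proof -
    have "minor F j i x = minor F j i (x(l := x i))" using l' by (simp add: not_dependsD)
    also have "\<dots> = h (x i)" unfolding minor_def h_def by (rule F_cong) (auto simp: E)
    finally show ?thesis .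
  qed
  have G2: "minor F i j x = h (x j)" for x
  proof -
    have "minor F i j x = minor F i j (x(l := x j))" using l by (simp add: not_dependsD)
    also have "\<dots> = h (x j)" unfolding minor_def h_def by (rule F_cong) (auto simp: E)
    finally show ?thesis .
  qed
  obtain u w where uw: "h u \<noteq> h w" using d unfolding depends_def G2 by auto
  have Fij: "F x = h (x i)" if "x i = x j" for x using minor_eq_if[of x i j F] G2 that by simp
  have Fli: "minor F l i = minor F j i \<Longrightarrow> x i = x l \<Longrightarrow> F x = h (x i)"
      "minor F l i = minor F i j \<Longrightarrow> x i = x l \<Longrightarrow> F x = h (x j)" for x
    using minor_eq_if[of x l i F] G1[of x] G2[of x] by simp_all
  have Flj: "minor F l j = minor F j i \<Longrightarrow> x j = x l \<Longrightarrow> F x = h (x i)"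
      "minor F l j = minor F i j \<Longrightarrow> x j = x l \<Longrightarrow> F x = h (x j)" for x
    using minor_eq_if[of x l j F] G1[of x] G2[of x] by simp_all
  have rep: "x i = x j \<or> x i = x l \<or> x j = x l" if "repeats E x" for x :: "'v \<Rightarrow> 'a"
    using that by (auto simp: repeats_def E)
  have lc: "minor F l j = minor F i j \<or> minor F l j = minor F j i"
    using minor_at_pair[OF maximal_pair_commute[OF mp], of l] l l' by auto
  consider (first) "minor F l i = minor F j i" "minor F l j = minor F j i"
    | (second) "minor F l i = minor F i j" "minor F l j = minor F i j"
    | (majority) "minor F l i = minor F j i" "minor F l j = minor F i j"
    | (minority) "minor F l i = minor F i j" "minor F l j = minor F j i"
    using lc minor_at_pair[OF mp l] by blast
  then show ?thesis
  proof cases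
    case first
    show ?thesis
    proof (rule keeps_essential_if_diagonal_eq[where l = l and q = j and g = "minor F j i"])
      show "\<not> depends (minor F j i) j" using ij by (simp add: not_depends_minor)
      show "F x = minor F j i x" if "repeats E x" for x
        unfolding G1 using rep[OF that] Fij[of x] Fli(1)[OF first(1), of x] Flj(1)[OF first(2), of x] by metis
    qed (use l l' ij ne dep M in auto)
  next
    case second
    show ?thesis
    proof (rule keeps_essential_if_diagonal_eq[where l = l and q = i and g = "minor F i j"])
      show "\<not> depends (minor F i j) i" using ij by (simp add: not_depends_minor)
      show "F x = minor F i j x" if "repeats E x" for x
        unfolding G2 using rep[OF that] Fij[of x] Fli(2)[OF second(1), of x] Flj(2)[OF second(2), of x] by metis
    qed (use l l' ij ne dep M in auto)
  next
    case majority
    have v: "x i = x j \<Longrightarrow> F x = h (x i)" "x i = x l \<Longrightarrow> F x = h (x i)" "x j = x l \<Longrightarrow> F x = h (x j)" for x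
      by (fact Fij Fli(1)[OF majority(1)] Flj(2)[OF majority(2)])+
    have two: "F x = h a" if "r \<in> E" "s \<in> E" "r \<noteq> s" "x r = a" "x s = a" for x r s a
      using that v[of x] unfolding E by (metis insertE singletonD)
    show ?thesis
    proof (rule keeps_essential_if_diagonal_symmetric[where l = l and p = i and r = j])
      fix x :: "'v \<Rightarrow> 'a" and y z assume x: "repeats E x" and yz: "y \<in> E" "z \<in> E"
      let ?t = "\<lambda>k. if k = y then z else if k = z then y else k"
      obtain r s where rs: "r \<in> E" "s \<in> E" "r \<noteq> s" "x r = x s"
        using x by (auto simp: repeats_def)
      have "F (x(y := x z, z := x y)) = h (x r)"
        by (rule two[of "?t r" "?t s"]) (use rs yz in auto)
      also have "\<dots> = F x" by (rule two[of r s, symmetric]) (use rs in auto)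
      finally show "F (x(y := x z, z := x y)) = F x" .
    qed (use l ij ne dep M in auto)
  next
    case minority
    \<comment> \<open>With \<open>l\<close> in the repeated pair the odd entry decides; for
      \<open>x i = x j\<close> the common value does, as \<open>l\<close> is lost there. This is the
      Pixley pattern up to \<open>h\<close>.\<close>
    have v: "x i = x j \<Longrightarrow> F x = h (x i)" "x i = x l \<Longrightarrow> F x = h (x j)" "x j = x l \<Longrightarrow> F x = h (x i)" for x
      by (fact Fij Fli(2)[OF minority(1)] Flj(1)[OF minority(2)])+
    have wit: "\<exists>x b. (\<forall>k. k \<notin> M \<longrightarrow> x k = u) \<and> F (x(z := b)) \<noteq> F x"
      if "y \<in> M \<or> y = z" "F ((\<lambda>_. u)(y := w, z := w)) \<noteq> F ((\<lambda>_. u)(y := if y = z then u else w))" for y z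
      using that by (intro exI[of _ "(\<lambda>_. u)(y := if y = z then u else w)"] exI[of _ w]) (auto split: if_splits)
    have vi: "F ((\<lambda>_. u)(i := w)) = h w" and vj: "F ((\<lambda>_. u)(j := w)) = h w"
      and vil: "F ((\<lambda>_. u)(i := w, l := w)) = h u" and vjl: "F ((\<lambda>_. u)(j := w, l := w)) = h u"
      and v0: "F (\<lambda>_. u) = h u"
      using v(3)[of "(\<lambda>_. u)(i := w)"] v(2)[of "(\<lambda>_. u)(j := w)"] v(2)[of "(\<lambda>_. u)(i := w, l := w)"]
        v(3)[of "(\<lambda>_. u)(j := w, l := w)"] v(1)[of "\<lambda>_. u"] ne ij by simp_all
    show ?thesis
    \<comment> \<open>At the constant tuple \<open>u\<close>, changing \<open>l\<close> alone to
      \<open>w\<close> has no effect; it acts only after some \<open>y\<close> in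
      \<open>{i, j}\<close> has moved to \<open>w\<close>. So \<open>M\<close> must contain such a
      \<open>y\<close>.\<close>
    proof (cases "M = {l}")
      case True
      then show ?thesis using keeps_essential_singleton[OF dep] l by auto
    next
      case False
      then obtain y where y: "y \<in> M" "y \<in> {i, j}" using M E by blast
      show ?thesis unfolding keeps_essential_def
      proof (rule exI[of _ "\<lambda>_. u"], rule ballI)
        fix z assume z: "z \<in> M"
        then consider "z = i" | "z = j" | "z = l" using M E by auto
        then show "\<exists>x b. (\<forall>k. k \<notin> M \<longrightarrow> x k = u) \<and> F (x(z := b)) \<noteq> F x"
        proof cases
          case 1 then show ?thesis using wit[of i i] vi v0 uw by (auto simp: fun_upd_idem)
        next
          case 2 then show ?thesis using wit[of j j] vj v0 uw by (auto simp: fun_upd_idem)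
        next
          case 3 then show ?thesis using wit[of y l] y ne vi vj vil vjl uw by auto
        qed
      qed
    qed
  qed
qed

section \<open>Assembling the cases\<close>

lemma keeps_essential_subset:
  assumes M: "M \<subseteq> E" "M \<noteq> {}"
  shows "keeps_essential F M"
proof (cases "M = E")
  case True
  \<comment> \<open>Here the outer variables do not affect \<open>F\<close>, so
    \<open>undefined\<close> is just some common assignment for them.\<close>
  show ?thesis unfolding keeps_essential_def True
  proof (rule exI[of _ undefined], rule ballI)
    fix i assume i: "i \<in> E"
    then obtain x b where x: "F (x(i := b)) \<noteq> F x" using dep[OF i] unfolding depends_def by blast
    let ?x = "\<lambda>z. if z \<in> E then x z else undefined z"
    have "F ?x = F x" "F (?x(i := b)) = F (x(i := b))" by (auto intro: F_cong)
    then show "\<exists>x b. (\<forall>j. j \<notin> E \<longrightarrow> x j = undefined j) \<and> F (x(i := b)) \<noteq> F x"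
      using x by (intro exI[of _ ?x] exI[of _ b]) auto
  qed
next
  case False
  then obtain c where c: "c \<in> E" "c \<notin> M" using M by auto
  obtain m where m: "m \<in> M" using M by auto
  show ?thesis
  proof (cases "M = {m}")
    case True
    then show ?thesis using keeps_essential_singleton[OF dep] M by auto
  next
    case False
    then obtain m' where m': "m' \<in> M" "m' \<noteq> m" using m by auto
    show ?thesis
    proof (cases "\<exists>i\<in>E. \<exists>j\<in>E. i \<noteq> j \<and> depends (minor F i j) j")
      case False
      then have cancel: "\<not> depends (minor F i j) j" if "i \<in> E" "j \<in> E" "i \<noteq> j" for i j
        using that by blast
      show ?thesis
      \<comment> \<open>Two elements of \<open>M\<close> and one outside it provide the three
        distinct variables.\<close>
      proof (rule keeps_essential_if_diagonal_symmetric[where l = m and p = m' and r = c])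
        show "F (x(i := x y, y := x i)) = F x" if "repeats E x" "i \<in> E" "y \<in> E" for x i y
          using swap_if_cancel[OF cancel that] by blast
      qed (use m m' c M dep in auto)
    next
      case True
      then obtain i j where mp: "maximal_pair i j" using ex_maximal_pair by blast
      then have ij: "i \<in> E" "j \<in> E" "i \<noteq> j" "depends (minor F i j) j" by (auto simp: maximal_pair_def)
      then obtain l where l: "l \<in> E - {i, j}" "\<not> depends (minor F i j) l" using loss by blast
      have l': "\<not> depends (minor F j i) l" using l ij depends_minor_commute_other[of i j l F] by auto
      show ?thesis
      proof (cases "E = {i, j, l}")
        case True
        then show ?thesis using keeps_essential_ternary mp l M c by blast
      next
        case False
        then obtain s where s: "s \<in> E - {i, j, l}" using l ij by auto
        have "card {i, j, l, s} \<le> card E" by (rule card_mono) (use finite_E l ij s in auto)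
        moreover have "card {i, j, l, s} = 4" using l ij s by auto
        ultimately have card: "card E \<ge> 4" by simp
        have off: "minor F l t = minor F l i" "minor F l t = minor F l j" if "t \<in> E - {i, j, l}" for t
          using minor_off_pair[OF mp l that] minor_off_pair[OF maximal_pair_commute[OF mp], of l t] l l' that
          by auto
        \<comment> \<open>The minors at \<open>i\<close> and \<open>j\<close> are linked through the
          fourth variable \<open>s\<close>.\<close>
        have eq: "minor F l p = minor F l i" if "p \<in> E - {l}" for p
          using off[OF s] off[of p] that by (cases "p \<in> {i, j}") auto
        obtain q where q: "q \<in> E - {l}" "\<not> depends (minor F l i) q" using loss l ij by blast
        show ?thesis
        proof (rule keeps_essential_if_diagonal_eq[where l = l and q = q and g = "minor F l i"])
          show "F x = minor F l i x" if "repeats E x" for x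
            using diagonal_from_equal_minors[OF card _ eq that] l by blast
          show "\<not> depends (minor F l i) l" using l by (auto simp: not_depends_minor)
        qed (use l q dep M c in auto)
      qed
    qed
  qed
qed

end

section \<open>Transfer to functions on \<open>Z_k^n\<close>\<close>

text \<open>Retracts all of \<open>nat \<Rightarrow> nat\<close> onto the tuples, so that no domain conditions are needed above.\<close>
definition clip :: "nat \<Rightarrow> nat \<Rightarrow> (nat \<Rightarrow> nat) \<Rightarrow> nat \<Rightarrow> nat" where
  "clip k n x = (\<lambda>i. if i < n then min (x i) (k - 1) else 0)"

lemma clip_tuples: "k > 0 \<Longrightarrow> clip k n x \<in> tuples k n"
  by (auto simp: clip_def tuples_def)

lemma clip_ident: "a \<in> tuples k n \<Longrightarrow> clip k n a = a"
  by (fastforce simp: clip_def tuples_def)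

lemma clip_upd: "i < n \<Longrightarrow> clip k n (x(i := b)) = (clip k n x)(i := min b (k - 1))"
  by (auto simp: clip_def)

lemma tuples_upd: "a \<in> tuples k n \<Longrightarrow> i < n \<Longrightarrow> b < k \<Longrightarrow> a(i := b) \<in> tuples k n"
  by (auto simp: tuples_def)

lemma not_essentialD:
  "\<not> essential k n f i \<Longrightarrow> a \<in> tuples k n \<Longrightarrow> i < n \<Longrightarrow> b < k \<Longrightarrow> f (a(i := b)) = f a"
  unfolding essential_def by metis

lemma depends_clip_iff:
  assumes "k > 0" "i < n"
  shows "depends (f \<circ> clip k n) i \<longleftrightarrow> essential k n f i"
proof
  assume "depends (f \<circ> clip k n) i"
  then obtain x b where "f ((clip k n x)(i := min b (k - 1))) \<noteq> f (clip k n x)"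
    using assms by (auto simp: depends_def clip_upd)
  moreover have "min b (k - 1) < k" using assms by auto
  ultimately show "essential k n f i"
    using not_essentialD[of k n f i "clip k n x"] clip_tuples assms by blast
next
  assume "essential k n f i"
  then obtain a b where a: "a \<in> tuples k n" "b < k" "f a \<noteq> f (a(i := b))"
    by (auto simp: essential_def)
  then show "depends (f \<circ> clip k n) i" unfolding depends_def
    using assms by (intro exI[of _ a] exI[of _ b]) (auto simp: clip_ident tuples_upd)
qed

text \<open>Coordinates are switched from \<open>a\<close> to \<open>b\<close> one at a time; each
  switch is void or along an inessential variable.\<close>

lemma agree_on_Ess:
  assumes k: "k > 0" and ab: "a \<in> tuples k n" "b \<in> tuples k n" and eq: "\<And>i. i \<in> Ess k n f \<Longrightarrow> a i = b i"
  shows "f a = f b"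
proof -
  have "f (\<lambda>i. if i < m then b i else a i) = f a" if "m \<le> n" for m using that
  proof (induction m)
    case (Suc m)
    let ?c = "\<lambda>i. if i < m then b i else a i"
    have c: "?c \<in> tuples k n" using ab by (auto simp: tuples_def)
    have bm: "b m < k" using ab Suc by (auto simp: tuples_def)
    have e: "(\<lambda>i. if i < Suc m then b i else a i) = ?c(m := b m)" by (auto simp: less_Suc_eq)
    have "f (?c(m := b m)) = f ?c"
    proof (cases "essential k n f m")
      case True
      then have "?c(m := b m) = ?c" using eq by (auto simp: Ess_def)
      then show ?thesis by simp
    next
      case False
      then show ?thesis using not_essentialD c bm Suc by (meson Suc_le_lessD)
    qed
    then show ?case using Suc e by simp
  qed simp
  from this[of n] have "f (\<lambda>i. if i < n then b i else a i) = f a" by simp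
  moreover have "(\<lambda>i. if i < n then b i else a i) = b" using ab by (auto simp: tuples_def)
  ultimately show ?thesis by simp
qed

lemma finite_Ess [simp]: "finite (Ess k n f)"
  by (rule finite_subset[of _ "{..<n}"]) (auto simp: Ess_def essential_def)

text \<open>A subfunction step may assign only to a variable essential in the current function.
  Other variables of \<open>S\<close> are skipped, which changes no value on tuples.\<close>

lemma fix_variables:
  assumes "finite S" "S \<subseteq> {..<n}" "c \<in> tuples k n"
  shows "\<exists>g. (subf_step k n)\<^sup>*\<^sup>* f g \<and> (\<forall>a\<in>tuples k n. g a = f (\<lambda>i. if i \<in> S then c i else a i))"
  using assms(1,2)
proof (induction S)
  case empty
  then show ?case by auto
next
  case (insert i S)
  then obtain g where g: "(subf_step k n)\<^sup>*\<^sup>* f g"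
    and ga: "\<And>a. a \<in> tuples k n \<Longrightarrow> g a = f (\<lambda>i. if i \<in> S then c i else a i)" by auto
  have i: "i < n" "c i < k" using insert assms by (auto simp: tuples_def)
  have eq: "g (a(i := c i)) = f (\<lambda>j. if j \<in> insert i S then c j else a j)" if "a \<in> tuples k n" for a
  proof -
    have "(\<lambda>j. if j \<in> S then c j else (a(i := c i)) j) = (\<lambda>j. if j \<in> insert i S then c j else a j)"
      using insert by auto
    then show ?thesis using ga[OF tuples_upd[OF that i]] by simp
  qed
  show ?case
  proof (cases "essential k n g i")
    case True
    then have "subf_step k n g (\<lambda>a. g (a(i := c i)))" using i by (auto simp: subf_step_def)
    then have "(subf_step k n)\<^sup>*\<^sup>* f (\<lambda>a. g (a(i := c i)))" using g by simp
    then show ?thesis using eq by blast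
  next
    case False
    then have "g a = f (\<lambda>j. if j \<in> insert i S then c j else a j)" if "a \<in> tuples k n" for a
      using eq[OF that] not_essentialD[OF False that i] by simp
    then show ?thesis using g by blast
  qed
qed

lemma separable_if_keeps_essential:
  assumes k: "k > 0" and M: "M \<subseteq> Ess k n f" "M \<noteq> {}" and M_dep: "keeps_essential (f \<circ> clip k n) M"
  shows "separable k n f M"
proof -
  obtain c where c: "\<And>i. i \<in> M \<Longrightarrow> \<exists>x b. (\<forall>j. j \<notin> M \<longrightarrow> x j = c j) \<and>
      f (clip k n (x(i := b))) \<noteq> f (clip k n x)"
    using M_dep by (auto simp: keeps_essential_def)
  let ?S = "{..<n} - M"
  have Mn: "M \<subseteq> {..<n}" using M by (auto simp: Ess_def essential_def)
  obtain g where g: "(subf_step k n)\<^sup>*\<^sup>* f g"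
    and ga: "\<And>a. a \<in> tuples k n \<Longrightarrow> g a = f (\<lambda>i. if i \<in> ?S then clip k n c i else a i)"
    using fix_variables[of ?S n "clip k n c" k f] clip_tuples[OF k] by auto
  have "i \<in> Ess k n g" if i: "i \<in> M" for i
  proof -
    obtain x b where x: "\<forall>j. j \<notin> M \<longrightarrow> x j = c j" "f (clip k n (x(i := b))) \<noteq> f (clip k n x)"
      using c i by blast
    have gf: "g (clip k n y) = f (clip k n y)" if "\<forall>j. j \<notin> M \<longrightarrow> y j = c j" for y
    proof -
      have "(\<lambda>i. if i \<in> ?S then clip k n c i else clip k n y i) = clip k n y"
        using that by (auto simp: clip_def)
      then show ?thesis using ga[OF clip_tuples[OF k]] by simp
    qed
    have "depends (g \<circ> clip k n) i" unfolding depends_def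
      using x gf[of x] gf[of "x(i := b)"] i by (intro exI[of _ x] exI[of _ b]) auto
    then show ?thesis using depends_clip_iff[OF k] i Mn by (auto simp: Ess_def)
  qed
  moreover have "i \<in> M" if Eg: "i \<in> Ess k n g" for i
  proof (rule ccontr)
    assume n: "i \<notin> M"
    obtain a b where a: "i < n" "a \<in> tuples k n" "b < k" "g a \<noteq> g (a(i := b))"
      using Eg by (auto simp: Ess_def essential_def)
    have "(\<lambda>j. if j \<in> ?S then clip k n c j else (a(i := b)) j) = (\<lambda>j. if j \<in> ?S then clip k n c j else a j)"
      using n a by auto
    then show False using ga[of a] ga[OF tuples_upd[OF a(2,1,3)]] a by simp
  qed
  ultimately have "M = Ess k n g" by auto
  then show ?thesis using M g by (auto simp: separable_def)
qed

text \<open>All arities are at most \<open>n\<close>, so \<open>Max\<close> is taken over a finite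
  set.\<close>

lemma gap_le:
  assumes "h \<in> Mnr k n f"
  shows "gap k n f \<le> int (ess k n f) - int (ess k n h)"
proof -
  have le: "ess k n h \<le> n" for h
    using card_mono[of "{..<n}" "Ess k n h"] by (auto simp: ess_def Ess_def essential_def)
  have "finite (ess k n ` Mnr k n f)" by (rule finite_subset[of _ "{..n}"]) (use le in auto)
  then have "ess k n h \<le> Max (ess k n ` Mnr k n f)" using assms by (intro Max_ge) auto
  then show ?thesis by (simp add: gap_def)
qed

theorem theorem6:
  fixes k n :: nat and f :: "(nat \<Rightarrow> nat) \<Rightarrow> nat"
  assumes "k \<ge> 2"
    and "in_Pkn k n f"
    and "ess k n f \<ge> 2"
    and "gap k n f \<ge> 2"
  shows "\<forall>M. M \<noteq> {} \<and> M \<subseteq> Ess k n f \<longrightarrow> separable k n f M"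
proof -
  have k: "k > 0" using assms by simp
  interpret nontrivial_gap "f \<circ> clip k n" "Ess k n f"
  proof
    show "(f \<circ> clip k n) x = (f \<circ> clip k n) y" if "\<And>i. i \<in> Ess k n f \<Longrightarrow> x i = y i" for x y
      using agree_on_Ess[OF k clip_tuples[OF k] clip_tuples[OF k], of n f x y] that
      by (auto simp: clip_def)
    show "depends (f \<circ> clip k n) i" if "i \<in> Ess k n f" for i
      using that depends_clip_iff[OF k] by (auto simp: Ess_def essential_def)
    fix i j assume ij: "i \<in> Ess k n f" "j \<in> Ess k n f" "i \<noteq> j"
    let ?h = "\<lambda>a. f (a(i := a j))"
    have n: "i < n" "j < n" using ij by (auto simp: Ess_def essential_def)
    have "?h \<in> Mnr k n f" unfolding Mnr_def mem_Collect_eq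
      by (rule tranclp.r_into_trancl) (use ij in \<open>unfold minor_step_def Ess_def, blast\<close>)
    then have "card (Ess k n ?h) + 2 \<le> card (Ess k n f)"
      using gap_le[of ?h k n f] assms by (simp add: ess_def)
    moreover have "card (Ess k n f) = Suc (card (Ess k n f - {i}))"
      using ij by (metis card_Suc_Diff1 finite_Ess)
    \<comment> \<open>The minor has at most \<open>card (Ess k n f) - 2\<close> essential variables,
      too few to keep everything except \<open>i\<close>.\<close>
    ultimately have "\<not> Ess k n f - {i} \<subseteq> Ess k n ?h"
      using card_mono[OF finite_Ess, of "Ess k n f - {i}" k n ?h] by linarith
    then obtain l where l: "l \<in> Ess k n f - {i}" "\<not> essential k n ?h l" by (auto simp: Ess_def)
    \<comment> \<open>Clipping acts coordinatewise and \<open>i\<close>, \<open>j\<close> are below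
      \<open>n\<close>, so it commutes with the identification.\<close>
    have "minor (f \<circ> clip k n) i j = ?h \<circ> clip k n"
    proof
      fix x
      have "clip k n (x(i := x j)) = (clip k n x)(i := clip k n x j)" using n by (auto simp: clip_def)
      then show "minor (f \<circ> clip k n) i j x = (?h \<circ> clip k n) x" by (simp add: minor_def)
    qed
    then have "\<not> depends (minor (f \<circ> clip k n) i j) l"
      using l depends_clip_iff[OF k, of l n ?h] by (auto simp: Ess_def essential_def)
    then show "\<exists>l\<in>Ess k n f - {i}. \<not> depends (minor (f \<circ> clip k n) i j) l" using l by blast
  qed simp
  show ?thesis using keeps_essential_subset separable_if_keeps_essential[OF k] by blast
qed

end
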